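(* Let $G$ be a tree or a connected graph with girth $g(G)\ge 7$, having $n$ vertices, $m$ edges and diameter $d$. Let $M_1,M_2$ be the first and second Zagreb indices of $G$, and let $0<\alpha<1$. Put \[ L=\alpha^{d}\bigl(n(n-1)+M_1-2m-2M_2\bigr)+2\alpha^{3}(M_2+m)+\alpha^{2}M_1(1-2\alpha)+2m\alpha(1-\alpha), \] \[ U=\alpha^{4}\bigl(n(n-1)+M_1-2m-2M_2\bigr)+2\alpha^{3}(M_2+m)+\alpha^{2}M_1(1-2\alpha)+2m\alpha(1-\alpha). \] Then $L\le GC(G)\le U$, and \[ \frac{n(n-1)+M_1-2m-2M_2}{2^{d}}+\frac{M_2+3m}{4}\;\le\; C(G)\;\le\;\frac{n(n-1)+M_1+2M_2+10m}{16}. \] In each formula, equality holds (in both inequalities) if the diameter $d$ is at most $4$.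
   Context: All graphs are finite and simple. The girth $g(G)$ is the length of a shortest cycle in $G$. For vertices $i,j$ of a connected graph $G$, $d(i,j)$ is their distance; the diameter is $\max_{i,j}d(i,j)$. With $d_v$ the degree of $v$, the first Zagreb index is $M_1(G)=\sum_{v\in V(G)}d_v^2$ and the second Zagreb index is $M_2(G)=\sum_{uv\in E(G)}d_ud_v$. The closeness is $C(G)=\sum_{i\in V(G)}\sum_{j\neq i}2^{-d(i,j)}$, and for fixed $0<\alpha<1$ the generalized closeness is $GC(G)=\sum_{i\in V(G)}\sum_{j\neq i}\alpha^{d(i,j)}$. *)

theory Defs
  imports
    Complex_Main
    "HOL-Library.Extended_Nat"
    "Graph_Theory.Graph_Theory"
begin

text \<open>
  Finite simple graphs are the instances of locale \<^locale>\<open>graph\<close>: every edge $uv$ is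
  represented by the two arcs from $u$ to $v$ and from $v$ to $u$, with no loops and no parallel
  arcs. Hence the degree of $v$ is \<^term>\<open>out_degree G v\<close>, whereas the number of edges is the
  number of unordered pairs of ends, not the number of arcs.
\<close>

definition edges :: "('a, 'b) pre_digraph \<Rightarrow> 'a set set" where
  "edges G = (\<lambda>a. {tail G a, head G a}) ` arcs G"

text \<open>
  The library notions of cycle and tree are for digraphs: there, $u, v, u$ is a cycle whenever
  $uv$ is an edge. In a simple undirected graph cycles have at least three edges.
\<close>

definition undirected_cycle :: "('a, 'b) pre_digraph \<Rightarrow> 'b awalk \<Rightarrow> bool" where
  "undirected_cycle G p \<longleftrightarrow> pre_digraph.cycle G p \<and> 3 \<le> length p"

definition undirected_tree :: "('a, 'b) pre_digraph \<Rightarrow> bool" where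
  "undirected_tree G \<longleftrightarrow> Digraph_Component.connected G \<and> (\<nexists>p. undirected_cycle G p)"

text \<open>The girth of an acyclic graph is \<^term>\<open>\<infinity> :: enat\<close>.\<close>

definition girth :: "('a, 'b) pre_digraph \<Rightarrow> enat" where
  "girth G = (INF p \<in> {p. undirected_cycle G p}. enat (length p))"

text \<open>Only meaningful if \<open>v\<close> is reachable from \<open>u\<close>.\<close>

definition graph_dist :: "('a, 'b) pre_digraph \<Rightarrow> 'a \<Rightarrow> 'a \<Rightarrow> nat" where
  "graph_dist G u v = (LEAST k. \<exists>p. pre_digraph.awalk G u p v \<and> length p = k)"

definition graph_diameter :: "('a, 'b) pre_digraph \<Rightarrow> nat" where
  "graph_diameter G = Max {graph_dist G u v | u v. u \<in> verts G \<and> v \<in> verts G}"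

definition zagreb1 :: "('a, 'b) pre_digraph \<Rightarrow> nat" where
  "zagreb1 G = (\<Sum>v \<in> verts G. (out_degree G v)\<^sup>2)"

definition zagreb2 :: "('a, 'b) pre_digraph \<Rightarrow> nat" where
  "zagreb2 G = (\<Sum>e \<in> edges G. \<Prod>v \<in> e. out_degree G v)"

definition gen_closeness :: "real \<Rightarrow> ('a, 'b) pre_digraph \<Rightarrow> real" where
  "gen_closeness \<alpha> G = (\<Sum>i \<in> verts G. \<Sum>j \<in> verts G - {i}. \<alpha> ^ graph_dist G i j)"

definition closeness :: "('a, 'b) pre_digraph \<Rightarrow> real" where
  "closeness G = (\<Sum>i \<in> verts G. \<Sum>j \<in> verts G - {i}. 1 / 2 ^ graph_dist G i j)"

end

theory Submission
  imports Defs
begin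

text \<open>
  If \<open>G\<close> has no cycle of length at most 6, then two vertices are joined by at most one path of
  length at most 3, and such a path is a shortest one. Hence the ordered pairs of vertices at
  distance 1, 2 and 3 correspond to the paths of these lengths, and counting the latter by their
  middle vertex or middle edge gives \<open>2m\<close>, \<open>M\<^sub>1 - 2m\<close> and \<open>2M\<^sub>2 - 2M\<^sub>1 + 2m\<close>. The
  \<open>n(n - 1) + M\<^sub>1 - 2m - 2M\<^sub>2\<close> remaining pairs have distance between 4 and \<open>d\<close>; there are none
  if \<open>d \<le> 3\<close>.
\<close>

(* The function-space arrow makes the notation for adjacency ambiguous. *)
unbundle no funcset_syntax

text \<open>Used to split the minimality condition on distances 2 and 3 into finitely many explicit
  cases.\<close>

lemma all_less_2_iff: "(\<forall>j < (2::nat). P j) \<longleftrightarrow> P 0 \<and> P 1"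
  by (auto simp: less_2_cases_iff)

lemma all_less_3_iff: "(\<forall>j < (3::nat). P j) \<longleftrightarrow> P 0 \<and> P 1 \<and> P 2"
  by (auto simp: numeral_3_eq_3 numeral_2_eq_2 less_Suc_eq)

section \<open>Walks as powers of adjacency, cycles as vertex lists\<close>

context wf_digraph
begin

text \<open>Replaces arc lists by relation powers, so that short walks unfold into chains of
  adjacent vertices. The conjunct \<open>u \<in> verts G\<close> matters at \<open>k = 0\<close>,
  where the power is the identity on the whole type.\<close>

lemma ex_awalk_length_iff:
  "(\<exists>p. awalk u p v \<and> length p = k) \<longleftrightarrow> u \<in> verts G \<and> (u, v) \<in> arcs_ends G ^^ k"
proof (induction k arbitrary: u)
  case 0
  then show ?case by (auto simp: awalk_Nil_iff)
next
  case (Suc k)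
  have "(\<exists>p. awalk u p v \<and> length p = Suc k)
      \<longleftrightarrow> (\<exists>e \<in> arcs G. u = tail G e \<and> (\<exists>p. awalk (head G e) p v \<and> length p = k))"
    (is "?L \<longleftrightarrow> ?R")
  proof
    assume ?L
    then show ?R by (auto simp: length_Suc_conv awalk_Cons_iff) blast
  next
    assume ?R
    then obtain e p where "e \<in> arcs G" "u = tail G e" "awalk (head G e) p v" "length p = k"
      by auto
    then show ?L by (intro exI[of _ "e # p"]) (simp add: awalk_Cons_iff)
  qed
  also have "\<dots> \<longleftrightarrow> (\<exists>w. u \<rightarrow> w \<and> (w, v) \<in> arcs_ends G ^^ k)"
    unfolding Suc.IH by (auto simp: arcs_ends_conv)
  also have "\<dots> \<longleftrightarrow> u \<in> verts G \<and> (u, v) \<in> arcs_ends G ^^ Suc k"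
    by (metis adj_in_verts(1) relpow_Suc_D2 relpow_Suc_I2)
  finally show ?case .
qed

lemma graph_dist_eq_Least_relpow:
  assumes "u \<in> verts G"
  shows "graph_dist G u v = (LEAST k. (u, v) \<in> arcs_ends G ^^ k)"
  unfolding graph_dist_def ex_awalk_length_iff using assms by simp

lemma ex_awalk_of_successively:
  assumes "u \<in> verts G" "successively (dominates G) (u # xs)"
  shows "\<exists>p. awalk u p (last (u # xs)) \<and> awalk_verts u p = u # xs"
  using assms
proof (induction xs arbitrary: u)
  case Nil
  then show ?case by (intro exI[of _ "[]"]) (simp add: awalk_Nil_iff)
next
  case (Cons w xs)
  then have "u \<rightarrow> w" and "w \<in> verts G" by auto
  then obtain e where e: "e \<in> arcs G" "tail G e = u" "head G e = w"
    by (auto simp: arcs_ends_conv)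
  obtain p where "awalk w p (last (w # xs))" "awalk_verts w p = w # xs"
    using Cons.IH[OF \<open>w \<in> verts G\<close>] Cons.prems by auto
  with e show ?case by (intro exI[of _ "e # p"]) (auto simp: awalk_Cons_iff)
qed

text \<open>Lets cycles be exhibited by their vertices alone. With at least two vertices besides
  \<open>u\<close> the closed walk has at least three arcs, which excludes going back and forth
  along one edge.\<close>

lemma ex_undirected_cycle_of_successively:
  assumes "successively (dominates G) (u # xs @ [u])" "distinct (u # xs)" "2 \<le> length xs"
  shows "\<exists>p. undirected_cycle G p \<and> length p = Suc (length xs)"
proof -
  have "u \<in> verts G" using assms by (cases xs) auto
  then obtain p where p: "awalk u p u" "awalk_verts u p = u # xs @ [u]"
    using ex_awalk_of_successively[OF _ assms(1)] by auto
  then have len: "length p = Suc (length xs)"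
    using length_awalk_verts[of u p] by simp
  with p assms have "cycle p"
    unfolding cycle_def by (intro exI[of _ u]) auto
  with len assms(3) show ?thesis by (auto simp: undirected_cycle_def)
qed

end

lemma length_ge_girth:
  assumes "undirected_cycle G p"
  shows "girth G \<le> enat (length p)"
  unfolding girth_def using assms by (auto intro: INF_lower)

text \<open>The infimum of the empty set in \<open>enat\<close> is \<open>\<infinity>\<close>. Hence
  trees fall under the case of girth at least 7.\<close>

lemma undirected_tree_girth:
  assumes "undirected_tree G"
  shows "girth G = \<infinity>"
  using assms by (auto simp: undirected_tree_def girth_def top_enat_def)

section \<open>Degree sums over arcs and edges\<close>

context graph
begin

lemma dominates_sym: "u \<rightarrow> v \<Longrightarrow> v \<rightarrow> u"
  using sym_arcs by (auto simp: symmetric_def sym_def)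

lemma dominates_irrefl: "\<not> u \<rightarrow> u"
  using no_loops by (auto simp: arcs_ends_conv)

lemma finite_nbrs: "finite {w. v \<rightarrow> w}"
  by (rule finite_subset[OF _ finite_verts]) auto

lemma finite_arcs_ends: "finite (arcs_ends G)"
  by (simp add: arcs_ends_def)

text \<open>Without parallel arcs, \<open>head G\<close> is injective on the arcs leaving
  \<open>v\<close>.\<close>

lemma card_nbrs: "card {w. v \<rightarrow> w} = out_degree G v"
proof -
  have "{w. v \<rightarrow> w} = head G ` out_arcs G v"
    by (auto simp: arcs_ends_conv out_arcs_def image_iff)
  moreover have "inj_on (head G) (out_arcs G v)"
    by (auto simp: inj_on_def out_arcs_def arc_to_ends_def intro: no_multi_arcs)
  ultimately show ?thesis by (simp add: card_image out_degree_def)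
qed

lemma sum_arcs_ends_tail:
  fixes f :: "'a \<Rightarrow> 'c::semiring_1"
  shows "(\<Sum>(u, v) \<in> arcs_ends G. f u) = (\<Sum>u \<in> verts G. of_nat (out_degree G u) * f u)"
proof -
  have "(SIGMA u : verts G. {w. u \<rightarrow> w}) = arcs_ends G" by auto
  then have "(\<Sum>(u, v) \<in> arcs_ends G. f u) = (\<Sum>u \<in> verts G. \<Sum>v \<in> {w. u \<rightarrow> w}. f u)"
    by (subst sum.Sigma) (simp_all add: finite_nbrs)
  then show ?thesis by (simp add: card_nbrs)
qed

text \<open>Each edge is the image of exactly two ordered pairs, which differ because there are no
  loops.\<close>

lemma sum_arcs_ends_edges:
  fixes f :: "'a set \<Rightarrow> 'c::semiring_1"
  shows "(\<Sum>(u, v) \<in> arcs_ends G. f {u, v}) = 2 * (\<Sum>e \<in> edges G. f e)"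
proof -
  have edges: "edges G = (\<lambda>(u, v). {u, v}) ` arcs_ends G"
    by (auto simp: edges_def arcs_ends_conv image_image)
  have "(\<Sum>(u, v) \<in> arcs_ends G. f {u, v})
      = (\<Sum>e \<in> edges G. \<Sum>(u, v) \<in> {q \<in> arcs_ends G. (\<lambda>(u, v). {u, v}) q = e}. f {u, v})"
    unfolding edges by (rule sum.image_gen[OF finite_arcs_ends])
  also have "\<dots> = (\<Sum>e \<in> edges G. 2 * f e)"
  proof (rule sum.cong[OF refl])
    fix e assume "e \<in> edges G"
    then obtain u v where uv: "u \<rightarrow> v" "e = {u, v}" by (auto simp: edges)
    have "(\<lambda>(u, v). {u, v}) q = e \<longleftrightarrow> q = (u, v) \<or> q = (v, u)" for q
      by (cases q) (simp add: uv(2) doubleton_eq_iff)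
    then have "{q \<in> arcs_ends G. (\<lambda>(u, v). {u, v}) q = e}
        = {q \<in> arcs_ends G. q = (u, v) \<or> q = (v, u)}"
      by (simp only:)
    also have "\<dots> = {(u, v), (v, u)}"
      using uv(1) dominates_sym[OF uv(1)] by blast
    finally have "{q \<in> arcs_ends G. (\<lambda>(u, v). {u, v}) q = e} = {(u, v), (v, u)}" .
    moreover have "u \<noteq> v" using uv dominates_irrefl by auto
    ultimately show "(\<Sum>(u, v) \<in> {q \<in> arcs_ends G. (\<lambda>(u, v). {u, v}) q = e}. f {u, v}) = 2 * f e"
      using uv by (simp add: insert_commute mult_2)
  qed
  finally show ?thesis by (simp add: sum_distrib_left)
qed

lemma card_arcs_ends: "card (arcs_ends G) = 2 * card (edges G)"
  using sum_arcs_ends_edges[of "\<lambda>_. 1 :: nat"] by (simp add: case_prod_unfold)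

lemma sum_out_degree: "(\<Sum>v \<in> verts G. out_degree G v) = 2 * card (edges G)"
  using sum_arcs_ends_tail[of "\<lambda>_. 1 :: nat"] card_arcs_ends by (simp add: case_prod_unfold)

lemma sum_arcs_ends_out_degree: "(\<Sum>(u, v) \<in> arcs_ends G. out_degree G u) = zagreb1 G"
  using sum_arcs_ends_tail[of "out_degree G"] by (simp add: zagreb1_def power2_eq_square)

text \<open>Swapping the ends permutes the symmetric relation \<open>arcs_ends G\<close>.\<close>

lemma sum_arcs_ends_out_degree': "(\<Sum>(u, v) \<in> arcs_ends G. out_degree G v) = zagreb1 G"
proof -
  have "(\<Sum>(u, v) \<in> arcs_ends G. out_degree G v) = (\<Sum>(u, v) \<in> arcs_ends G. out_degree G u)"
    by (rule sum.reindex_bij_witness[of _ prod.swap prod.swap]) (auto intro: dominates_sym)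
  then show ?thesis by (simp add: sum_arcs_ends_out_degree)
qed

lemma sum_arcs_ends_out_degree_mult:
  "(\<Sum>(u, v) \<in> arcs_ends G. out_degree G u * out_degree G v) = 2 * zagreb2 G"
proof -
  have "(\<Sum>(u, v) \<in> arcs_ends G. out_degree G u * out_degree G v)
      = (\<Sum>(u, v) \<in> arcs_ends G. \<Prod>w \<in> {u, v}. out_degree G w)"
  proof (rule sum.cong[OF refl], clarify)
    fix u v assume "u \<rightarrow> v"
    \<comment> \<open>If the ends coincided, the product over the set \<open>{u, v}\<close> would
      have a single factor.\<close>
    then have "u \<noteq> v" using dominates_irrefl by auto
    then show "out_degree G u * out_degree G v = (\<Prod>w \<in> {u, v}. out_degree G w)" by simp
  qed
  also have "\<dots> = 2 * zagreb2 G"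
    unfolding zagreb2_def by (rule sum_arcs_ends_edges)
  finally show ?thesis .
qed

text \<open>
  The middle comes first: \<open>(w, u, v)\<close> stands for the path \<open>u w v\<close>, and \<open>((x, y), u, v)\<close> for
  \<open>u x y v\<close>. In \<open>paths3\<close> the condition \<open>u \<noteq> v\<close> is left out; it follows if there are no triangles.
\<close>

definition paths2 :: "('a \<times> 'a \<times> 'a) set" where
  "paths2 = (SIGMA w : verts G. SIGMA u : {u. w \<rightarrow> u}. {v. w \<rightarrow> v} - {u})"

definition paths3 :: "(('a \<times> 'a) \<times> 'a \<times> 'a) set" where
  "paths3 = (SIGMA a : arcs_ends G.
     ({u. fst a \<rightarrow> u} - {snd a}) \<times> ({v. snd a \<rightarrow> v} - {fst a}))"

section \<open>Numbers of paths with two and three edges\<close>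

text \<open>A middle vertex \<open>w\<close> of degree \<open>k\<close> has
  \<open>k * (k - 1)\<close> ordered pairs of distinct neighbours; the squares sum to
  \<open>zagreb1 G\<close>, the degrees to twice the number of edges.\<close>

lemma card_paths2: "real (card paths2) = real (zagreb1 G) - 2 * real (card (edges G))"
proof -
  have inner: "card (SIGMA u : {u. w \<rightarrow> u}. {v. w \<rightarrow> v} - {u})
      = out_degree G w * (out_degree G w - 1)" for w
    by (subst card_SigmaI) (auto simp: finite_nbrs card_nbrs card_Diff_singleton)
  have "card paths2 = (\<Sum>w \<in> verts G. out_degree G w * (out_degree G w - 1))"
    unfolding paths2_def
    by (subst card_SigmaI) (auto simp: finite_nbrs inner)
  \<comment> \<open>The degree sum is added on the left rather than subtracted on the right, since
    subtraction on naturals is truncated.\<close>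
  then have "card paths2 + (\<Sum>w \<in> verts G. out_degree G w)
      = (\<Sum>w \<in> verts G. out_degree G w * (out_degree G w - 1) + out_degree G w)"
    by (simp add: sum.distrib)
  also have "\<dots> = zagreb1 G"
    unfolding zagreb1_def
    by (rule sum.cong) (auto simp: power2_eq_square algebra_simps diff_mult_distrib2)
  finally have "card paths2 + 2 * card (edges G) = zagreb1 G"
    by (simp add: sum_out_degree)
  then show ?thesis by linarith
qed

text \<open>A middle arc \<open>(x, y)\<close> extends independently at both ends, in
  \<open>out_degree G x - 1\<close> and \<open>out_degree G y - 1\<close> ways. Expanding the
  product gives the three sums over arcs computed before and the number of arcs.\<close>

lemma card_paths3:
  "real (card paths3) = 2 * real (zagreb2 G) - 2 * real (zagreb1 G) + 2 * real (card (edges G))"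
proof -
  have "card paths3 = (\<Sum>a \<in> arcs_ends G.
      card (({u. fst a \<rightarrow> u} - {snd a}) \<times> ({v. snd a \<rightarrow> v} - {fst a})))"
    unfolding paths3_def
    by (rule card_SigmaI) (auto simp: finite_nbrs finite_arcs_ends)
  also have "real \<dots> = (\<Sum>(x, y) \<in> arcs_ends G.
      (real (out_degree G x) - 1) * (real (out_degree G y) - 1))"
    unfolding of_nat_sum
  proof (rule sum.cong[OF refl], clarify)
    fix x y assume xy: "x \<rightarrow> y"
    have c: "real (card ({u. a \<rightarrow> u} - {b})) = real (out_degree G a) - 1" if "a \<rightarrow> b" for a b
    proof -
      have "b \<in> {u. a \<rightarrow> u}" using that by simp
      then have "card {u. a \<rightarrow> u} = Suc (card ({u. a \<rightarrow> u} - {b}))"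
        by (metis card.remove finite_nbrs)
      then show ?thesis by (simp add: card_nbrs)
    qed
    show "real (card (({u. fst (x, y) \<rightarrow> u} - {snd (x, y)}) \<times> ({v. snd (x, y) \<rightarrow> v} - {fst (x, y)})))
        = (real (out_degree G x) - 1) * (real (out_degree G y) - 1)"
      using c[OF xy] c[OF dominates_sym[OF xy]] by (simp add: card_cartesian_product)
  qed
  also have "\<dots> = (\<Sum>(x, y) \<in> arcs_ends G. real (out_degree G x * out_degree G y))
      - (\<Sum>(x, y) \<in> arcs_ends G. real (out_degree G x))
      - (\<Sum>(x, y) \<in> arcs_ends G. real (out_degree G y)) + real (card (arcs_ends G))"
    by (simp add: case_prod_unfold algebra_simps sum.distrib sum_subtractf)
  also have "\<dots> = 2 * real (zagreb2 G) - 2 * real (zagreb1 G) + 2 * real (card (edges G))"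
    using arg_cong[OF sum_arcs_ends_out_degree_mult, of real]
      arg_cong[OF sum_arcs_ends_out_degree, of real]
      arg_cong[OF sum_arcs_ends_out_degree', of real]
    by (simp add: case_prod_unfold card_arcs_ends)
  finally show ?thesis .
qed

lemma graph_dist_le_diameter:
  assumes "u \<in> verts G" "v \<in> verts G"
  shows "graph_dist G u v \<le> graph_diameter G"
proof -
  have "{graph_dist G u v |u v. u \<in> verts G \<and> v \<in> verts G}
      = (\<lambda>(u, v). graph_dist G u v) ` (verts G \<times> verts G)" by auto
  then show ?thesis
    unfolding graph_diameter_def using assms by (auto intro!: Max_ge)
qed

end

section \<open>Excluding short closed walks\<close>

locale graph_girth_ge_7 = graph +
  assumes connected: "Digraph_Component.connected G"
    and girth_ge_7: "7 \<le> girth G"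
begin

text \<open>The cycle has \<open>Suc (length xs)\<close> edges, so the two bounds on
  \<open>xs\<close> cover exactly the lengths 3 to 6.\<close>

lemma no_short_cycle:
  assumes "successively (dominates G) (u # xs @ [u])" "distinct (u # xs)"
    and "2 \<le> length xs" "length xs \<le> 5"
  shows False
proof -
  obtain p where p: "undirected_cycle G p" "length p = Suc (length xs)"
    using ex_undirected_cycle_of_successively assms by blast
  have "7 \<le> enat (length p)"
    using girth_ge_7 length_ge_girth[OF p(1)] by (rule order_trans)
  then show False
    using p(2) assms(4) by (simp add: numeral_eq_enat)
qed

lemma no_triangle: "a \<rightarrow> b \<Longrightarrow> b \<rightarrow> c \<Longrightarrow> c \<rightarrow> a \<Longrightarrow> False"
  using no_short_cycle[of a "[b, c]"] dominates_irrefl by auto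

lemma no_4_cycle:
  "a \<rightarrow> b \<Longrightarrow> b \<rightarrow> c \<Longrightarrow> c \<rightarrow> d \<Longrightarrow> d \<rightarrow> a \<Longrightarrow> a = c \<or> b = d"
  using no_short_cycle[of a "[b, c, d]"] dominates_irrefl by auto

text \<open>Degenerate closed walks are excluded as well: if two vertices two steps apart coincide,
  the remaining three steps form a triangle. For example, \<open>a = c\<close> leaves
  \<open>c\<close>, \<open>d\<close>, \<open>e\<close>.\<close>

lemma no_5_cycle:
  assumes "a \<rightarrow> b" "b \<rightarrow> c" "c \<rightarrow> d" "d \<rightarrow> e" "e \<rightarrow> a"
  shows False
proof -
  have "a \<noteq> c" "b \<noteq> d" "c \<noteq> e" "d \<noteq> a" "e \<noteq> b"
    using assms no_triangle by blast+
  moreover have "a \<noteq> b" "b \<noteq> c" "c \<noteq> d" "d \<noteq> e" "e \<noteq> a"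
    using assms dominates_irrefl by blast+
  ultimately show False
    using no_short_cycle[of a "[b, c, d, e]"] assms by auto
qed

text \<open>The inequalities forbid backtracking. Opposite vertices cannot coincide either, as this
  would split the walk into two triangles.\<close>

lemma no_6_cycle:
  assumes "a \<rightarrow> b" "b \<rightarrow> c" "c \<rightarrow> d" "d \<rightarrow> e" "e \<rightarrow> f" "f \<rightarrow> a"
    and "a \<noteq> c" "b \<noteq> d" "c \<noteq> e" "d \<noteq> f" "e \<noteq> a" "f \<noteq> b"
  shows False
proof -
  have "a \<noteq> d" "b \<noteq> e" "c \<noteq> f"
    using assms no_triangle by blast+
  moreover have "a \<noteq> b" "b \<noteq> c" "c \<noteq> d" "d \<noteq> e" "e \<noteq> f" "f \<noteq> a"
    using assms dominates_irrefl by blast+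
  ultimately show False
    using no_short_cycle[of a "[b, c, d, e, f]"] assms by auto
qed

section \<open>Pairs at distance 1, 2 and 3\<close>

text \<open>By symmetry of the arcs, connectedness gives a walk from \<open>u\<close> to
  \<open>v\<close>; so the \<open>LEAST\<close> defining the distance is attained.\<close>

lemma relpow_graph_dist:
  assumes "u \<in> verts G" "v \<in> verts G"
  shows "(u, v) \<in> arcs_ends G ^^ graph_dist G u v"
proof -
  have "u \<rightarrow>\<^sup>* v"
    using symmetric_connected_imp_strongly_connected[OF sym_arcs connected] assms by auto
  then obtain p where "awalk u p v" by (auto simp: reachable_awalk)
  then have "(u, v) \<in> arcs_ends G ^^ length p" using ex_awalk_length_iff by blast
  then show ?thesis
    unfolding graph_dist_eq_Least_relpow[OF assms(1)] by (rule LeastI)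
qed

lemma graph_dist_eq_iff:
  assumes "u \<in> verts G" "v \<in> verts G"
  shows "graph_dist G u v = k
    \<longleftrightarrow> (u, v) \<in> arcs_ends G ^^ k \<and> (\<forall>j < k. (u, v) \<notin> arcs_ends G ^^ j)"
proof
  assume "graph_dist G u v = k"
  then show "(u, v) \<in> arcs_ends G ^^ k \<and> (\<forall>j < k. (u, v) \<notin> arcs_ends G ^^ j)"
    using relpow_graph_dist[OF assms] graph_dist_eq_Least_relpow[OF assms(1), of v]
    by (metis not_less_Least)
next
  assume "(u, v) \<in> arcs_ends G ^^ k \<and> (\<forall>j < k. (u, v) \<notin> arcs_ends G ^^ j)"
  then show "graph_dist G u v = k"
    unfolding graph_dist_eq_Least_relpow[OF assms(1)]
    by (intro Least_equality) (auto simp: not_less[symmetric])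
qed

lemma relpow_2_iff: "(u, v) \<in> arcs_ends G ^^ 2 \<longleftrightarrow> (\<exists>w. u \<rightarrow> w \<and> w \<rightarrow> v)"
  by (auto simp: numeral_2_eq_2)

lemma relpow_3_iff: "(u, v) \<in> arcs_ends G ^^ 3 \<longleftrightarrow> (\<exists>x y. u \<rightarrow> x \<and> x \<rightarrow> y \<and> y \<rightarrow> v)"
  by (auto simp: numeral_3_eq_3)

definition at_dist :: "nat \<Rightarrow> ('a \<times> 'a) set" where
  "at_dist k = {(u, v). u \<in> verts G \<and> v \<in> verts G \<and> graph_dist G u v = k}"

lemma at_dist_conv:
  "at_dist k = {(u, v). u \<in> verts G \<and> v \<in> verts G \<and> (u, v) \<in> arcs_ends G ^^ k
     \<and> (\<forall>j < k. (u, v) \<notin> arcs_ends G ^^ j)}"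
  unfolding at_dist_def using graph_dist_eq_iff by auto

lemma at_dist_1: "at_dist 1 = arcs_ends G"
  using dominates_irrefl by (auto simp: at_dist_conv)

text \<open>Two distinct vertices with a common neighbour are not adjacent, because there are no
  triangles.\<close>

lemma at_dist_2: "at_dist 2 = snd ` paths2"
proof -
  have "(u, v) \<in> at_dist 2 \<longleftrightarrow> (\<exists>w. w \<rightarrow> u \<and> w \<rightarrow> v \<and> u \<noteq> v)" for u v
    unfolding at_dist_conv all_less_2_iff
    using no_triangle dominates_sym by (auto simp: relpow_2_iff) blast+
  moreover have "(u, v) \<in> snd ` paths2 \<longleftrightarrow> (\<exists>w. w \<rightarrow> u \<and> w \<rightarrow> v \<and> u \<noteq> v)" for u v
    unfolding paths2_def image_iff Bex_def using adj_in_verts(1) by auto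
  ultimately show ?thesis by (simp add: set_eq_iff)
qed

text \<open>A walk \<open>u\<close>, \<open>x\<close>, \<open>y\<close>, \<open>v\<close> without
  backtracking is shortest: a connection of length 0, 1 or 2 would close it to a triangle, a 4-cycle
  or a closed walk of length 5.\<close>

lemma at_dist_3: "at_dist 3 = snd ` paths3"
proof -
  have "(u, v) \<in> at_dist 3
      \<longleftrightarrow> (\<exists>x y. x \<rightarrow> y \<and> x \<rightarrow> u \<and> u \<noteq> y \<and> y \<rightarrow> v \<and> v \<noteq> x)" (is "?L \<longleftrightarrow> ?R") for u v
  proof
    assume ?L
    then show ?R
      unfolding at_dist_conv all_less_3_iff
      \<comment> \<open>If \<open>u = y\<close> or \<open>v = x\<close>, then \<open>u\<close> and
        \<open>v\<close> would be adjacent, against the minimality of 3.\<close>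
      by (auto simp: relpow_2_iff relpow_3_iff) (metis dominates_sym)
  next
    assume ?R
    then obtain x y where xy: "u \<rightarrow> x" "x \<rightarrow> y" "y \<rightarrow> v" "u \<noteq> y" "v \<noteq> x"
      using dominates_sym by blast
    have "u \<noteq> v" using xy no_triangle by blast
    moreover have "\<not> u \<rightarrow> v" using xy no_4_cycle dominates_sym by blast
    moreover have "\<not> (u \<rightarrow> w \<and> w \<rightarrow> v)" for w using xy no_5_cycle dominates_sym by blast
    moreover have "u \<in> verts G" "v \<in> verts G" using xy by auto
    ultimately show ?L
      unfolding at_dist_conv all_less_3_iff using xy by (auto simp: relpow_2_iff relpow_3_iff)
  qed
  moreover have "(u, v) \<in> snd ` paths3
      \<longleftrightarrow> (\<exists>x y. x \<rightarrow> y \<and> x \<rightarrow> u \<and> u \<noteq> y \<and> y \<rightarrow> v \<and> v \<noteq> x)" for u v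
    unfolding paths3_def image_iff Bex_def by simp
  ultimately show ?thesis by (simp add: set_eq_iff)
qed

text \<open>Two different middle vertices would form a 4-cycle with \<open>u\<close> and
  \<open>v\<close>.\<close>

lemma inj_on_paths2: "inj_on snd paths2"
proof (rule inj_onI, clarsimp)
  fix w u v w'
  assume "(w, u, v) \<in> paths2" "(w', u, v) \<in> paths2"
  then have "w \<rightarrow> u" "w \<rightarrow> v" "w' \<rightarrow> u" "w' \<rightarrow> v" "u \<noteq> v" by (auto simp: paths2_def)
  then show "w = w'" using no_4_cycle dominates_sym by blast
qed

text \<open>If both inner vertices differ, the two paths close up to a 6-cycle; if exactly one
  differs, they contain a 4-cycle.\<close>

lemma inj_on_paths3: "inj_on snd paths3"
proof (rule inj_onI, clarsimp)
  fix x y u v x' y'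
  assume "((x, y), u, v) \<in> paths3" "((x', y'), u, v) \<in> paths3"
  then have p: "u \<rightarrow> x" "x \<rightarrow> y" "y \<rightarrow> v" "u \<noteq> y" "x \<noteq> v"
      "u \<rightarrow> x'" "x' \<rightarrow> y'" "y' \<rightarrow> v" "u \<noteq> y'" "x' \<noteq> v"
    by (auto simp: paths3_def intro: dominates_sym)
  have "x = x' \<or> y = y'"
    using no_6_cycle[of u x y v y' x'] p dominates_sym by blast
  moreover have "y = y'" if "x = x'"
    using no_4_cycle[of x y v y'] p that dominates_sym by blast
  moreover have "x = x'" if "y = y'"
    using no_4_cycle[of u x y x'] p that dominates_sym by blast
  ultimately show "x = x' \<and> y = y'" by blast
qed

lemma card_at_dist_1: "real (card (at_dist 1)) = 2 * real (card (edges G))"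
  by (simp only: at_dist_1 card_arcs_ends of_nat_mult of_nat_numeral)

lemma card_at_dist_2: "real (card (at_dist 2)) = real (zagreb1 G) - 2 * real (card (edges G))"
  by (simp add: at_dist_2 card_image[OF inj_on_paths2] card_paths2)

lemma card_at_dist_3:
  "real (card (at_dist 3))
     = 2 * real (zagreb2 G) - 2 * real (zagreb1 G) + 2 * real (card (edges G))"
  by (simp add: at_dist_3 card_image[OF inj_on_paths3] card_paths3)

section \<open>Pairs at distance at least 4\<close>

definition far :: "('a \<times> 'a) set" where
  "far = {(u, v). u \<in> verts G \<and> v \<in> verts G \<and> 4 \<le> graph_dist G u v}"

lemma finite_at_dist: "finite (at_dist k)"
  by (rule finite_subset[of _ "verts G \<times> verts G"]) (auto simp: at_dist_def)

lemma finite_far: "finite far"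
  by (rule finite_subset[of _ "verts G \<times> verts G"]) (auto simp: far_def)

text \<open>Stated for any function of the distance so as to serve twice: with the constant 1 it
  determines the number of far pairs, with powers of \<alpha> it gives the generalized
  closeness.\<close>

lemma sum_distinct_pairs:
  fixes f :: "nat \<Rightarrow> real"
  shows "(\<Sum>i \<in> verts G. \<Sum>j \<in> verts G - {i}. f (graph_dist G i j))
    = real (card (at_dist 1)) * f 1 + real (card (at_dist 2)) * f 2
      + real (card (at_dist 3)) * f 3 + (\<Sum>(u, v) \<in> far. f (graph_dist G u v))"
proof -
  let ?F = "\<lambda>(u, v). f (graph_dist G u v)"
  have const: "sum ?F (at_dist k) = real (card (at_dist k)) * f k" for k
  proof -
    have "sum ?F (at_dist k) = (\<Sum>_ \<in> at_dist k. f k)"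
      by (rule sum.cong) (auto simp: at_dist_def)
    then show ?thesis by simp
  qed
  have zero: "graph_dist G u v = 0 \<longleftrightarrow> u = v" if "u \<in> verts G" "v \<in> verts G" for u v
    using graph_dist_eq_iff[OF that, of 0] by simp
  have "(\<Sum>i \<in> verts G. \<Sum>j \<in> verts G - {i}. f (graph_dist G i j))
      = sum ?F (SIGMA i : verts G. verts G - {i})"
    by (subst sum.Sigma) auto
  also have "(SIGMA i : verts G. verts G - {i}) = at_dist 1 \<union> at_dist 2 \<union> at_dist 3 \<union> far"
  proof -
    have "v \<noteq> u \<longleftrightarrow> graph_dist G u v = 1 \<or> graph_dist G u v = 2 \<or> graph_dist G u v = 3
        \<or> 4 \<le> graph_dist G u v" if "u \<in> verts G" "v \<in> verts G" for u v
    proof -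
      have "k = 1 \<or> k = 2 \<or> k = 3 \<or> 4 \<le> k \<longleftrightarrow> k \<noteq> 0" for k :: nat by presburger
      then show ?thesis using zero[OF that] by metis
    qed
    then show ?thesis unfolding at_dist_def far_def by blast
  qed
  also have "sum ?F \<dots> = sum ?F (at_dist 1) + sum ?F (at_dist 2) + sum ?F (at_dist 3) + sum ?F far"
  proof -
    have "at_dist 1 \<inter> at_dist 2 = {}" "(at_dist 1 \<union> at_dist 2) \<inter> at_dist 3 = {}"
        "(at_dist 1 \<union> at_dist 2 \<union> at_dist 3) \<inter> far = {}"
      by (auto simp: at_dist_def far_def)
    then show ?thesis
      by (simp add: sum.union_disjoint finite_at_dist finite_far del: One_nat_def)
  qed
  finally show ?thesis by (simp only: const)
qed

text \<open>There are \<open>n * (n - 1)\<close> ordered pairs of distinct vertices in all;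
  subtracting the counts for distances 1, 2 and 3 leaves the far pairs.\<close>

lemma card_far:
  "real (card far) = real (card (verts G)) * (real (card (verts G)) - 1) + real (zagreb1 G)
     - 2 * real (card (edges G)) - 2 * real (zagreb2 G)"
proof -
  have "(\<Sum>i \<in> verts G. \<Sum>j \<in> verts G - {i}. 1 :: real)
      = real (card (verts G)) * (real (card (verts G)) - 1)"
  proof -
    have "real (card (verts G - {i})) = real (card (verts G)) - 1" if "i \<in> verts G" for i
      using card.remove[OF finite_verts that] by simp
    then show ?thesis by simp
  qed
  moreover have "(\<Sum>(u, v) \<in> far. 1) = real (card far)"
    by (simp add: case_prod_unfold)
  ultimately have "real (card (verts G)) * (real (card (verts G)) - 1)
      = 2 * real (card (edges G)) + (real (zagreb1 G) - 2 * real (card (edges G)))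
        + (2 * real (zagreb2 G) - 2 * real (zagreb1 G) + 2 * real (card (edges G)))
        + real (card far)"
    using sum_distinct_pairs[of "\<lambda>_. 1"]
    by (simp only: card_at_dist_1 card_at_dist_2 card_at_dist_3 mult_1_right)
  then show ?thesis by simp
qed

text \<open>On \<open>far\<close> the exponents lie between 4 and the diameter, and powers of
  \<alpha> decrease. At diameter 4 both bounds agree; below 4 the set \<open>far\<close> is empty
  and all three quantities vanish.\<close>

lemma sum_far_bounds:
  fixes \<alpha> :: real
  assumes "0 < \<alpha>" "\<alpha> < 1"
  defines "S \<equiv> (\<Sum>(u, v) \<in> far. \<alpha> ^ graph_dist G u v)"
  shows "\<alpha> ^ graph_diameter G * real (card far) \<le> S" (is ?lower)
    and "S \<le> \<alpha> ^ 4 * real (card far)" (is ?upper)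
    and "graph_diameter G \<le> 4 \<Longrightarrow>
      S = \<alpha> ^ graph_diameter G * real (card far) \<and> S = \<alpha> ^ 4 * real (card far)"
proof -
  have "\<alpha> ^ graph_diameter G \<le> \<alpha> ^ graph_dist G u v" "\<alpha> ^ graph_dist G u v \<le> \<alpha> ^ 4"
    if "(u, v) \<in> far" for u v
    using that assms graph_dist_le_diameter by (auto simp: far_def intro!: power_decreasing)
  then have "(\<Sum>_ \<in> far. \<alpha> ^ graph_diameter G) \<le> S" "S \<le> (\<Sum>_ \<in> far. \<alpha> ^ 4)"
    unfolding S_def by (intro sum_mono; clarsimp)+
  then show lower: ?lower and upper: ?upper
    by (simp_all add: mult.commute)
  assume d: "graph_diameter G \<le> 4"
  show "S = \<alpha> ^ graph_diameter G * real (card far) \<and> S = \<alpha> ^ 4 * real (card far)"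
  proof (cases "graph_diameter G = 4")
    case True
    with lower upper show ?thesis by simp
  next
    case False
    with d have "graph_dist G u v < 4" if "u \<in> verts G" "v \<in> verts G" for u v
      using graph_dist_le_diameter[OF that] by simp
    then have "far = {}" by (force simp: far_def)
    then show ?thesis by (simp add: S_def)
  qed
qed

lemma gen_closeness_eq:
  "gen_closeness \<alpha> G = 2 * real (card (edges G)) * \<alpha>
     + (real (zagreb1 G) - 2 * real (card (edges G))) * \<alpha>\<^sup>2
     + (2 * real (zagreb2 G) - 2 * real (zagreb1 G) + 2 * real (card (edges G))) * \<alpha> ^ 3
     + (\<Sum>(u, v) \<in> far. \<alpha> ^ graph_dist G u v)"
  unfolding gen_closeness_def sum_distinct_pairs card_at_dist_1 card_at_dist_2 card_at_dist_3
  by simp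

end

section \<open>The bounds for both closeness measures\<close>

lemma closeness_eq_gen_closeness: "closeness G = gen_closeness (1 / 2) G"
  by (simp add: closeness_def gen_closeness_def power_divide)

theorem theorem3p5:
  fixes G :: "('a, 'b) pre_digraph"
    and n m M1 M2 \<alpha> L U :: real and d :: nat
  assumes "graph G"
    and "undirected_tree G \<or> (Digraph_Component.connected G \<and> 7 \<le> girth G)"
    and "n = real (card (verts G))"
    and "m = real (card (edges G))"
    and "d = graph_diameter G"
    and "M1 = real (zagreb1 G)"
    and "M2 = real (zagreb2 G)"
    and "0 < \<alpha>" and "\<alpha> < 1"
    and "L = \<alpha> ^ d * (n * (n - 1) + M1 - 2 * m - 2 * M2) + 2 * \<alpha> ^ 3 * (M2 + m)
              + \<alpha>\<^sup>2 * M1 * (1 - 2 * \<alpha>) + 2 * m * \<alpha> * (1 - \<alpha>)"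
    and "U = \<alpha> ^ 4 * (n * (n - 1) + M1 - 2 * m - 2 * M2) + 2 * \<alpha> ^ 3 * (M2 + m)
              + \<alpha>\<^sup>2 * M1 * (1 - 2 * \<alpha>) + 2 * m * \<alpha> * (1 - \<alpha>)"
  shows "L \<le> gen_closeness \<alpha> G \<and> gen_closeness \<alpha> G \<le> U
    \<and> (n * (n - 1) + M1 - 2 * m - 2 * M2) / 2 ^ d + (M2 + 3 * m) / 4 \<le> closeness G
    \<and> closeness G \<le> (n * (n - 1) + M1 + 2 * M2 + 10 * m) / 16
    \<and> (d \<le> 4 \<longrightarrow>
         gen_closeness \<alpha> G = L \<and> gen_closeness \<alpha> G = U
       \<and> closeness G = (n * (n - 1) + M1 - 2 * m - 2 * M2) / 2 ^ d + (M2 + 3 * m) / 4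
       \<and> closeness G = (n * (n - 1) + M1 + 2 * M2 + 10 * m) / 16)"
proof -
  have "Digraph_Component.connected G" "7 \<le> girth G"
    using assms(2) undirected_tree_girth[of G] by (auto simp: undirected_tree_def)
  then interpret graph_girth_ge_7 G
    using assms(1) by (simp add: graph_girth_ge_7_def graph_girth_ge_7_axioms_def)
  \<comment> \<open>\<open>K\<close> is the bracket common to \<open>L\<close>, \<open>U\<close> and
    the lower bound for the closeness; it counts the far pairs.\<close>
  define K where "K = n * (n - 1) + M1 - 2 * m - 2 * M2"
  define S where "S a = (\<Sum>(u, v) \<in> far. a ^ graph_dist G u v)" for a :: real
  have K: "real (card far) = K"
    unfolding K_def assms(3-7) by (rule card_far)
  \<comment> \<open>All terms but \<open>S a\<close> also occur in \<open>L\<close> and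
    \<open>U\<close>, so only \<open>S a\<close> has to be estimated. The base \<open>a\<close>
    stays general because both \<alpha> and 1/2 are needed.\<close>
  have GC: "gen_closeness a G = S a + 2 * a ^ 3 * (M2 + m) + a\<^sup>2 * M1 * (1 - 2 * a)
      + 2 * m * a * (1 - a)" for a
    unfolding gen_closeness_eq S_def assms(3-7)
    by (simp add: algebra_simps power2_eq_square power3_eq_cube)
  \<comment> \<open>At base 1/2 the factor \<open>1 - 2 * a\<close> vanishes and removes the
    \<open>M1\<close> term; the rest is \<open>(M2 + m) / 4 + m / 2\<close>.\<close>
  have C: "closeness G = S (1 / 2) + (M2 + 3 * m) / 4"
    unfolding closeness_eq_gen_closeness GC by (simp add: field_simps power3_eq_cube power2_eq_square)
  have S: "a ^ d * K \<le> S a" "S a \<le> a ^ 4 * K"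
      "d \<le> 4 \<Longrightarrow> S a = a ^ d * K \<and> S a = a ^ 4 * K" if "0 < a" "a < 1" for a
    using sum_far_bounds[OF that] unfolding S_def K assms(5) by blast+
  have L: "L = \<alpha> ^ d * K + 2 * \<alpha> ^ 3 * (M2 + m) + \<alpha>\<^sup>2 * M1 * (1 - 2 * \<alpha>) + 2 * m * \<alpha> * (1 - \<alpha>)"
    unfolding K_def by (rule assms)
  have U: "U = \<alpha> ^ 4 * K + 2 * \<alpha> ^ 3 * (M2 + m) + \<alpha>\<^sup>2 * M1 * (1 - 2 * \<alpha>) + 2 * m * \<alpha> * (1 - \<alpha>)"
    unfolding K_def by (rule assms)
  have CL: "K / 2 ^ d + (M2 + 3 * m) / 4 = (1 / 2) ^ d * K + (M2 + 3 * m) / 4"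
    by (simp add: power_divide)
  have CU: "(n * (n - 1) + M1 + 2 * M2 + 10 * m) / 16 = (1 / 2) ^ 4 * K + (M2 + 3 * m) / 4"
    by (simp add: K_def field_simps)
  show ?thesis
    unfolding K_def[symmetric] CL CU C GC L U
    using S[of \<alpha>] S[of "1 / 2"] assms(8,9) by (auto simp del: mult_cancel_right)
qed

end
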